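(* The sequence $\{G_k\}_{k\ge 1}$ of Erdős–Hajnal shift graphs is a Ramsey sequence. In particular, it is an ascending sequence with $\omega(G_k)=2$ for all $k$ and $\lim_{k\to\infty}\chi(G_k)=\infty$ that is a Ramsey sequence.
   Context: For a positive integer $k$, the Erdős–Hajnal shift graph $G_k$ has vertex set $\{[i,j] : i,j \text{ integers}, 1 \le i < j \le 2^k+1\}$, and two vertices $[i,j]$ and $[\ell,m]$ are adjacent if and only if $j=\ell$ or $m=i$. (These graphs are triangle-free, so $\omega(G_k)=2$, and $\chi(G_k)=k+1$.) A sequence of graphs $\{H_k\}$ is ascending if $H_k$ is isomorphic to a proper subgraph of $H_{k+1}$ for every positive integer $k$. An ascending sequence $\{H_k\}$ is a Ramsey sequence if for every positive integer $k$ there exists an integer $n>k$ such that every red-blue coloring of the edges of $H_n$ contains a monochromatic (all red or all blue) subgraph isomorphic to $H_k$. *)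

theory Defs
  imports Complex_Main
begin

record 'a sgraph =
  verts :: "'a set"
  edges :: "'a set set"

definition simple_graph :: "'a sgraph \<Rightarrow> bool" where
  "simple_graph G \<longleftrightarrow>
     finite (verts G) \<and> (\<forall>e \<in> edges G. e \<subseteq> verts G \<and> card e = 2)"

definition adjacent :: "'a sgraph \<Rightarrow> 'a \<Rightarrow> 'a \<Rightarrow> bool" where
  "adjacent G u v \<longleftrightarrow> {u, v} \<in> edges G"

definition subgraph :: "'a sgraph \<Rightarrow> 'a sgraph \<Rightarrow> bool" where
  "subgraph S G \<longleftrightarrow>
     simple_graph S \<and> simple_graph G \<and> verts S \<subseteq> verts G \<and> edges S \<subseteq> edges G"

definition proper_subgraph :: "'a sgraph \<Rightarrow> 'a sgraph \<Rightarrow> bool" where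
  "proper_subgraph S G \<longleftrightarrow> subgraph S G \<and> S \<noteq> G"

definition isomorphic :: "'a sgraph \<Rightarrow> 'b sgraph \<Rightarrow> bool" where
  "isomorphic G H \<longleftrightarrow>
     (\<exists>f. bij_betw f (verts G) (verts H) \<and>
          (\<forall>u \<in> verts G. \<forall>v \<in> verts G. adjacent G u v \<longleftrightarrow> adjacent H (f u) (f v)))"

definition clique :: "'a sgraph \<Rightarrow> 'a set \<Rightarrow> bool" where
  "clique G K \<longleftrightarrow>
     K \<subseteq> verts G \<and> (\<forall>u \<in> K. \<forall>v \<in> K. u \<noteq> v \<longrightarrow> adjacent G u v)"

definition clique_number :: "'a sgraph \<Rightarrow> nat" where
  "clique_number G = Max (card ` {K. clique G K})"

definition proper_coloring :: "'a sgraph \<Rightarrow> nat \<Rightarrow> ('a \<Rightarrow> nat) \<Rightarrow> bool" where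
  "proper_coloring G n c \<longleftrightarrow>
     (\<forall>v \<in> verts G. c v < n) \<and>
     (\<forall>u \<in> verts G. \<forall>v \<in> verts G. adjacent G u v \<longrightarrow> c u \<noteq> c v)"

definition chromatic_number :: "'a sgraph \<Rightarrow> nat" where
  "chromatic_number G = (LEAST n. \<exists>c. proper_coloring G n c)"

datatype color = Red | Blue

text \<open>
  An edge coloring of \<open>G\<close> is represented by a function on all sets of vertices;
  only its values on \<open>edges G\<close> are ever inspected.
\<close>

definition monochromatic :: "('a set \<Rightarrow> color) \<Rightarrow> 'a sgraph \<Rightarrow> bool" where
  "monochromatic c S \<longleftrightarrow> (\<forall>e \<in> edges S. c e = Red) \<or> (\<forall>e \<in> edges S. c e = Blue)"

text \<open>
  Sequences of graphs are indexed by the positive integers; the entry at index \<open>0\<close> is ignored.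
\<close>

definition ascending :: "(nat \<Rightarrow> 'a sgraph) \<Rightarrow> bool" where
  "ascending H \<longleftrightarrow>
     (\<forall>k\<ge>1. simple_graph (H k)) \<and>
     (\<forall>k\<ge>1. \<exists>S. proper_subgraph S (H (k + 1)) \<and> isomorphic (H k) S)"

definition ramsey_sequence :: "(nat \<Rightarrow> 'a sgraph) \<Rightarrow> bool" where
  "ramsey_sequence H \<longleftrightarrow>
     ascending H \<and>
     (\<forall>k\<ge>1. \<exists>n>k. \<forall>c :: 'a set \<Rightarrow> color.
        \<exists>S. subgraph S (H n) \<and> monochromatic c S \<and> isomorphic (H k) S)"

text \<open>The vertex \<open>[i, j]\<close> is the pair \<open>(i, j)\<close>.\<close>

definition shift_verts :: "nat \<Rightarrow> (int \<times> int) set" where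
  "shift_verts k = {(i, j). 1 \<le> i \<and> i < j \<and> j \<le> 2 ^ k + 1}"

definition shift_graph :: "nat \<Rightarrow> (int \<times> int) sgraph" where
  "shift_graph k =
     \<lparr>verts = shift_verts k,
      edges = {{(i, j), (l, m)} | i j l m.
                 (i, j) \<in> shift_verts k \<and> (l, m) \<in> shift_verts k \<and> (j = l \<or> m = i)}\<rparr>"

end

theory Submission
  imports Defs "HOL-Library.Ramsey"
begin

text \<open>
  A strictly increasing map of index sets induces an embedding of shift graphs. The edges of
  \<open>G\<^sub>n\<close> correspond to the triples \<open>x < y < z\<close> of indices, via \<open>{[x, y], [y, z]}\<close>, so Ramsey's
  theorem for triples yields a large index set all of whose triples give edges of one color; the
  shift graph on this index set is the monochromatic copy of \<open>G\<^sub>k\<close>. For the chromatic number,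
  in a proper coloring the sets of colors appearing on the vertices \<open>[i, _]\<close> are distinct
  for distinct \<open>i\<close>, so \<open>n\<close> colors suffice only if \<open>2\<^sup>k + 1 \<le> 2\<^sup>n\<close>.
\<close>

section \<open>Edges of shift graphs as increasing triples\<close>

lemma verts_shift_graph [simp]: "verts (shift_graph k) = shift_verts k"
  by (simp add: shift_graph_def)

text \<open>The alternatives \<open>j = l\<close> and \<open>m = i\<close> differ only in which end
  of the edge is named first, and a doubleton forgets this order. The resulting normal form by
  triples is what Ramsey's theorem is applied to.\<close>

lemma edges_shift_graph:
  "edges (shift_graph k) =
     {{(x, y), (y, z)} | x y z. 1 \<le> x \<and> x < y \<and> y < z \<and> z \<le> 2 ^ k + 1}"
proof (intro set_eqI iffI)
  fix e :: "(int \<times> int) set" assume "e \<in> edges (shift_graph k)"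
  then obtain i j l m where e: "e = {(i, j), (l, m)}"
    and v: "(i, j) \<in> shift_verts k" "(l, m) \<in> shift_verts k" and "j = l \<or> m = i"
    by (auto simp: shift_graph_def)
  from this(4) show "e \<in> {{(x, y), (y, z)} | x y z. 1 \<le> x \<and> x < y \<and> y < z \<and> z \<le> 2 ^ k + 1}"
  proof
    assume "j = l"
    with e v show ?thesis unfolding shift_verts_def by blast
  next
    assume "m = i"
    with e v have "e = {(l, m), (m, j)}" "1 \<le> l \<and> l < m \<and> m < j \<and> j \<le> 2 ^ k + 1"
      by (auto simp: shift_verts_def)
    then show ?thesis by blast
  qed
next
  fix e :: "(int \<times> int) set"
  assume "e \<in> {{(x, y), (y, z)} | x y z. 1 \<le> x \<and> x < y \<and> y < z \<and> z \<le> 2 ^ k + 1}"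
  then obtain x y z where "e = {(x, y), (y, z)}" "1 \<le> x" "x < y" "y < z" "z \<le> 2 ^ k + 1"
    by blast
  moreover from this have "(x, y) \<in> shift_verts k" "(y, z) \<in> shift_verts k"
    by (auto simp: shift_verts_def)
  ultimately show "e \<in> edges (shift_graph k)"
    unfolding shift_graph_def by auto
qed

lemma adjacent_shift_graph:
  "adjacent (shift_graph k) (i, j) (l, m) \<longleftrightarrow>
     (i, j) \<in> shift_verts k \<and> (l, m) \<in> shift_verts k \<and> (j = l \<or> m = i)"
  by (auto simp: adjacent_def edges_shift_graph shift_verts_def doubleton_eq_iff)

lemma finite_shift_verts: "finite (shift_verts k)"
  by (rule finite_subset[where B = "{1..2 ^ k + 1 :: int} \<times> {1..2 ^ k + 1 :: int}"]) (auto simp: shift_verts_def)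

lemma simple_graph_shift_graph: "simple_graph (shift_graph k)"
  using finite_shift_verts[of k] unfolding simple_graph_def
  by (auto simp: edges_shift_graph shift_verts_def)

section \<open>Embeddings induced by increasing index maps\<close>

definition image_graph :: "('a \<Rightarrow> 'b) \<Rightarrow> 'a sgraph \<Rightarrow> 'b sgraph" where
  "image_graph f G = \<lparr>verts = f ` verts G, edges = (`) f ` edges G\<rparr>"

text \<open>Edges of a simple graph lie within the vertices, where \<open>f\<close> is injective, so
  distinct edges keep distinct images and no new adjacency arises.\<close>

lemma isomorphic_image_graph:
  assumes "simple_graph G" and inj: "inj_on f (verts G)"
  shows "isomorphic G (image_graph f G)"
proof -
  have "{u, v} \<in> edges G \<longleftrightarrow> {f u, f v} \<in> (`) f ` edges G"
    if "u \<in> verts G" "v \<in> verts G" for u v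
  proof
    assume "{f u, f v} \<in> (`) f ` edges G"
    then obtain e where e: "e \<in> edges G" "f ` {u, v} = f ` e" by auto
    with assms(1) have "e \<subseteq> verts G" by (auto simp: simple_graph_def)
    with e(2) that have "{u, v} = e"
      using inj_on_image_eq_iff[OF inj, of "{u, v}" e] by simp
    with e(1) show "{u, v} \<in> edges G" by simp
  qed (auto intro: rev_image_eqI)
  with inj show ?thesis
    unfolding isomorphic_def adjacent_def image_graph_def
    by (intro exI[of _ f]) (simp add: inj_on_imp_bij_betw)
qed

lemma simple_graph_image_graph:
  assumes "simple_graph G" and inj: "inj_on f (verts G)"
  shows "simple_graph (image_graph f G)"
  using assms unfolding simple_graph_def image_graph_def
  by (auto simp: card_image inj_on_subset)

text \<open>Used twice: with the identity to get an ascending sequence, and with the enumeration of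
  a homogeneous index set to get the monochromatic copy.\<close>

lemma shift_graph_embedding:
  fixes g :: "int \<Rightarrow> int"
  assumes mono: "strict_mono_on {1..2 ^ k + 1} g"
    and range: "g ` {1..2 ^ k + 1} \<subseteq> {1..2 ^ n + 1}"
  shows "subgraph (image_graph (map_prod g g) (shift_graph k)) (shift_graph n)"
    and "isomorphic (shift_graph k) (image_graph (map_prod g g) (shift_graph k))"
proof -
  have "inj_on g {1..2 ^ k + 1}"
    using mono by (rule strict_mono_on_imp_inj_on)
  then have inj: "inj_on (map_prod g g) (verts (shift_graph k))"
    by (intro inj_on_subset[OF map_prod_inj_on]) (auto simp: shift_verts_def)
  then show "isomorphic (shift_graph k) (image_graph (map_prod g g) (shift_graph k))"
    by (rule isomorphic_image_graph[OF simple_graph_shift_graph])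
  have less: "g i < g j" if "1 \<le> i" "i < j" "j \<le> 2 ^ k + 1" for i j
    using that by (intro strict_mono_onD[OF mono]) auto
  have bound: "1 \<le> g i \<and> g i \<le> 2 ^ n + 1" if "1 \<le> i" "i \<le> 2 ^ k + 1" for i
    using range that by (auto simp: image_subset_iff)
  have "map_prod g g ` shift_verts k \<subseteq> shift_verts n"
    using less bound by (auto simp: shift_verts_def)
  moreover have "(`) (map_prod g g) ` edges (shift_graph k) \<subseteq> edges (shift_graph n)"
  proof clarify
    fix e assume "e \<in> edges (shift_graph k)"
    then obtain x y z where "e = {(x, y), (y, z)}" "1 \<le> x" "x < y" "y < z" "z \<le> 2 ^ k + 1"
      unfolding edges_shift_graph by blast
    moreover from this have "g x < g y" "g y < g z" "1 \<le> g x" "g z \<le> 2 ^ n + 1"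
      using less[of x y] less[of y z] bound[of x] bound[of z] by auto
    ultimately show "map_prod g g ` e \<in> edges (shift_graph n)"
      unfolding edges_shift_graph by auto
  qed
  ultimately show "subgraph (image_graph (map_prod g g) (shift_graph k)) (shift_graph n)"
    using simple_graph_image_graph[OF simple_graph_shift_graph inj] simple_graph_shift_graph
    by (simp add: subgraph_def image_graph_def)
qed

lemma ascending_shift_graph: "ascending shift_graph"
  unfolding ascending_def
proof (intro conjI allI impI simple_graph_shift_graph)
  fix k :: nat
  let ?S = "image_graph (map_prod id id) (shift_graph k)"
  have mono: "strict_mono_on {1..2 ^ k + 1} (id :: int \<Rightarrow> int)"
    by (simp add: strict_mono_on_def)
  have range: "id ` {1..2 ^ k + 1} \<subseteq> {1..2 ^ (k + 1) + 1 :: int}"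
    by auto
  \<comment> \<open>One missing vertex gives properness: its second index exceeds
    \<open>2 ^ k + 1\<close>.\<close>
  have "(1, 2 ^ (k + 1) + 1) \<in> verts (shift_graph (k + 1))" "(1, 2 ^ (k + 1) + 1) \<notin> verts ?S"
    by (auto simp: shift_verts_def image_graph_def)
  then have "?S \<noteq> shift_graph (k + 1)" by metis
  with shift_graph_embedding[OF mono range]
  show "\<exists>S. proper_subgraph S (shift_graph (k + 1)) \<and> isomorphic (shift_graph k) S"
    unfolding proper_subgraph_def by blast
qed

section \<open>Ramsey's theorem for triples and the monochromatic copy\<close>

lemma sorted_triple_eq_iff:
  fixes x y z :: "'a::linorder"
  assumes "x < y" "y < z" "x' < y'" "y' < z'"
  shows "{x, y, z} = {x', y', z'} \<longleftrightarrow> x = x' \<and> y = y' \<and> z = z'"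
proof
  assume eq: "{x, y, z} = {x', y', z'}"
  have "sorted_list_of_set {x, y, z} = [x, y, z]" "sorted_list_of_set {x', y', z'} = [x', y', z']"
    using assms
    by (auto intro!: sorted_list_of_set.idem_if_sorted_distinct[of "[_, _, _]", simplified])
  then have "[x, y, z] = [x', y', z']" unfolding eq by (rule trans[OF sym])
  then show "x = x' \<and> y = y' \<and> z = z'" by simp
qed auto

text \<open>All \<open>M \<ge> N\<close> are covered because the index sets of shift graphs have
  sizes of the form \<open>2 ^ n + 1\<close>, which \<open>N\<close> itself may miss.\<close>

lemma ramsey_ordered_triples:
  "\<exists>N::nat. \<forall>M\<ge>N. \<forall>P :: nat \<Rightarrow> nat \<Rightarrow> nat \<Rightarrow> bool. \<exists>H\<subseteq>{..<M}. card H = m \<and>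
     (\<exists>b. \<forall>x\<in>H. \<forall>y\<in>H. \<forall>z\<in>H. x < y \<longrightarrow> y < z \<longrightarrow> P x y z = b)"
proof -
  obtain N :: nat where N: "partn_lst {..<N} [m, m] 3"
    using ramsey_full by blast
  show ?thesis
  proof (intro exI[of _ N] allI impI)
    fix M :: nat and P :: "nat \<Rightarrow> nat \<Rightarrow> nat \<Rightarrow> bool"
    assume "N \<le> M"
    \<comment> \<open>A 3-element set has only one increasing enumeration, so on such sets
      \<open>f\<close> encodes the truth value of \<open>P\<close>.\<close>
    define f :: "nat set \<Rightarrow> nat" where
      "f X = (if \<exists>x y z. X = {x, y, z} \<and> x < y \<and> y < z \<and> P x y z then 0 else 1)" for X
    have f: "f {x, y, z} = (if P x y z then 0 else 1)" if "x < y" "y < z" for x y z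
      unfolding f_def using that by (auto simp: sorted_triple_eq_iff cong: conj_cong)
    have "f \<in> nsets {..<M} 3 \<rightarrow> {..<2}"
      by (auto simp: f_def)
    from partn_lstE[OF partn_lst_greater_resource[OF N \<open>N \<le> M\<close>] this]
    obtain i H where i: "i < Suc (Suc 0)" and H: "H \<in> nsets {..<M} ([m, m] ! i)"
      and fH: "f ` nsets H 3 \<subseteq> {i}"
      by auto
    \<comment> \<open>Both colors have target size \<open>m\<close>, so the size of \<open>H\<close>
      does not depend on which color occurs.\<close>
    from i have "[m, m] ! i = m" by (auto simp: less_Suc_eq)
    with H have "H \<subseteq> {..<M}" "card H = m" by (auto simp: nsets_def)
    moreover have "P x y z = (i = 0)" if "x \<in> H" "y \<in> H" "z \<in> H" "x < y" "y < z" for x y z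
    proof -
      have "{x, y, z} \<in> nsets H 3" using that by (auto simp: nsets_def)
      with fH have "f {x, y, z} = i" by auto
      with f[OF that(4,5)] show ?thesis by (auto split: if_splits)
    qed
    ultimately show "\<exists>H\<subseteq>{..<M}. card H = m \<and>
        (\<exists>b. \<forall>x\<in>H. \<forall>y\<in>H. \<forall>z\<in>H. x < y \<longrightarrow> y < z \<longrightarrow> P x y z = b)"
      by (intro exI[of _ H] exI[of _ "i = 0"] conjI ballI impI)
  qed
qed

lemma ramsey_sequence_shift_graph: "ramsey_sequence shift_graph"
  unfolding ramsey_sequence_def
proof (intro conjI allI impI ascending_shift_graph)
  fix k :: nat
  let ?m = "2 ^ k + 1 :: nat"
  obtain N :: nat where N: "\<And>M (P :: nat \<Rightarrow> nat \<Rightarrow> nat \<Rightarrow> bool). N \<le> M \<Longrightarrow>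
      \<exists>H\<subseteq>{..<M}. card H = ?m \<and>
        (\<exists>b. \<forall>x\<in>H. \<forall>y\<in>H. \<forall>z\<in>H. x < y \<longrightarrow> y < z \<longrightarrow> P x y z = b)"
    using ramsey_ordered_triples[of ?m] by metis
  \<comment> \<open>The first argument ensures \<open>n > k\<close>; the second, with
    \<open>n < 2 ^ n\<close>, provides enough indices for Ramsey's theorem.\<close>
  define n where "n = max (k + 1) N"
  have "N \<le> n" by (simp add: n_def)
  also have "n < 2 ^ n" by (rule less_exp)
  finally have "N \<le> 2 ^ n + 1" by simp
  note N = N[OF this]
  have "\<exists>S. subgraph S (shift_graph n) \<and> Defs.monochromatic c S \<and> isomorphic (shift_graph k) S"
    for c :: "(int \<times> int) set \<Rightarrow> color"
  proof -
    \<comment> \<open>Translates Ramsey's ground set, which starts at 0, to the indices of the shift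
      graph, which start at 1.\<close>
    define v :: "nat \<Rightarrow> int" where "v x = int x + 1" for x
    obtain H b where H: "H \<subseteq> {..<2 ^ n + 1}" "card H = ?m"
      and b: "\<forall>x\<in>H. \<forall>y\<in>H. \<forall>z\<in>H. x < y \<longrightarrow> y < z \<longrightarrow>
        (c {(v x, v y), (v y, v z)} = Red) = b"
      using N[of "\<lambda>x y z. c {(v x, v y), (v y, v z)} = Red"]
      by (elim exE conjE) (rule that)
    from H(1) have "finite H" by (rule finite_subset) simp
    \<comment> \<open>Enumerates \<open>H\<close> increasingly by 1, ..., \<open>2 ^ k + 1\<close>;
      list positions start at 0, hence \<open>i - 1\<close>.\<close>
    define h where "h i = sorted_list_of_set H ! nat (i - 1)" for i :: int
    define g where "g i = v (h i)" for i
    have h_in: "h i \<in> H" if "1 \<le> i" "i \<le> 2 ^ k + 1" for i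
    proof -
      have "nat (i - 1) < length (sorted_list_of_set H)"
        using that H(2) by (simp add: nat_less_iff)
      from nth_mem[OF this] show ?thesis
        using \<open>finite H\<close> by (simp add: h_def)
    qed
    have h_less: "h i < h j" if "1 \<le> i" "i < j" "j \<le> 2 ^ k + 1" for i j
      unfolding h_def using that H(2)
      by (intro sorted_wrt_nth_less[OF strict_sorted_list_of_set]) (auto simp: nat_less_iff)
    have mono: "strict_mono_on {1..2 ^ k + 1} g"
      unfolding g_def v_def
      by (intro strict_mono_onI add_strict_right_mono)
        (simp only: of_nat_less_iff atLeastAtMost_iff h_less)
    have range: "g ` {1..2 ^ k + 1} \<subseteq> {1..2 ^ n + 1}"
    proof clarify
      fix i :: int assume "i \<in> {1..2 ^ k + 1}"
      with h_in H(1) have "h i < 2 ^ n + 1" by auto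
      then show "g i \<in> {1..2 ^ n + 1}" by (simp add: g_def v_def)
    qed
    have "(c e = Red) = b" if e: "e \<in> edges (image_graph (map_prod g g) (shift_graph k))" for e
    proof -
      from e obtain x y z where "e = {(g x, g y), (g y, g z)}"
        and xyz: "1 \<le> x" "x < y" "y < z" "z \<le> 2 ^ k + 1"
        by (auto simp: image_graph_def edges_shift_graph)
      with b[rule_format, of "h x" "h y" "h z"] show ?thesis
        by (simp add: g_def h_in h_less)
    qed
    \<comment> \<open>If \<open>b\<close> is false, no edge of the copy is red, so with two colors
      all are blue.\<close>
    then have "Defs.monochromatic c (image_graph (map_prod g g) (shift_graph k))"
      unfolding Defs.monochromatic_def by (metis color.exhaust)
    with shift_graph_embedding[OF mono range] show ?thesis by blast
  qed
  moreover have "k < n" by (simp add: n_def)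
  ultimately show "\<exists>n>k. \<forall>c. \<exists>S. subgraph S (shift_graph n) \<and> Defs.monochromatic c S \<and>
      isomorphic (shift_graph k) S"
    by blast
qed

section \<open>Clique number\<close>

lemma card_le_2I:
  assumes "finite K" "\<And>a b c. \<lbrakk>a \<in> K; b \<in> K; c \<in> K; a \<noteq> b; a \<noteq> c; b \<noteq> c\<rbrakk> \<Longrightarrow> False"
  shows "card K \<le> 2"
proof (rule ccontr)
  assume "\<not> card K \<le> 2"
  then have "3 \<le> card K" by simp
  then obtain T where T: "T \<subseteq> K" "card T = 3" by (meson obtain_subset_with_card_n)
  from T(2) obtain a b c where "T = {a, b, c}" "a \<noteq> b" "b \<noteq> c" "a \<noteq> c"
    by (auto simp: card_3_iff)
  with T(1) show False by (intro assms(2)[of a b c]) auto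
qed

lemma clique_number_shift_graph:
  assumes "1 \<le> k"
  shows "clique_number (shift_graph k) = 2"
  unfolding clique_number_def
proof (rule Max_eqI)
  have "{K. Defs.clique (shift_graph k) K} \<subseteq> Pow (shift_verts k)"
    by (auto simp: Defs.clique_def)
  then show "finite (card ` {K. Defs.clique (shift_graph k) K})"
    by (intro finite_imageI) (rule finite_subset, auto simp: finite_shift_verts)
next
  fix n assume "n \<in> card ` {K. Defs.clique (shift_graph k) K}"
  then obtain K where n: "n = card K" and K: "Defs.clique (shift_graph k) K" by blast
  have "finite K"
    using K finite_subset[OF _ finite_shift_verts] by (auto simp: Defs.clique_def)
  moreover have False if "a \<in> K" "b \<in> K" "c \<in> K" "a \<noteq> b" "a \<noteq> c" "b \<noteq> c" for a b c
  proof -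
    have "adjacent (shift_graph k) a b" "adjacent (shift_graph k) a c"
      "adjacent (shift_graph k) b c"
      using K that by (auto simp: Defs.clique_def)
    \<comment> \<open>Direct each edge from the interval ending at the common index to the one
      starting there. A directed 3-cycle would make the indices increase around a circle. In a
      transitive triangle, the last two intervals both start where the first ends, yet the last also
      starts where the second ends.\<close>
    then show False
      by (cases a; cases b; cases c) (auto simp: adjacent_shift_graph shift_verts_def)
  qed
  ultimately show "n \<le> 2" unfolding n by (rule card_le_2I)
next
  \<comment> \<open>This makes index 3 available, hence the edge between \<open>[1, 2]\<close> and
    \<open>[2, 3]\<close>.\<close>
  have "(2 :: int) ^ 1 \<le> 2 ^ k"
    using assms by (intro power_increasing) auto
  then have "Defs.clique (shift_graph k) {(1, 2), (2, 3)}"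
    by (auto simp: Defs.clique_def adjacent_shift_graph shift_verts_def)
  then show "2 \<in> card ` {K. Defs.clique (shift_graph k) K}"
    by (intro rev_image_eqI[of "{(1, 2), (2, 3)}"]) auto
qed

section \<open>Chromatic number\<close>

lemma proper_coloring_shift_graph_imp_less:
  assumes "proper_coloring (shift_graph k) n c"
  shows "k < n"
proof -
  define S where "S i = {c (i, j) | j. i < j \<and> j \<le> 2 ^ k + 1}" for i :: int
  have neq: "S i \<noteq> S l" if "1 \<le> i" "i < l" "l \<le> 2 ^ k + 1" for i l
  proof
    assume "S i = S l"
    \<comment> \<open>If this color also lies in \<open>S l\<close>, it is the color of some
      \<open>[l, m]\<close>, a neighbor of \<open>[i, l]\<close>.\<close>
    moreover have "c (i, l) \<in> S i" using that by (auto simp: S_def)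
    ultimately obtain m where m: "c (i, l) = c (l, m)" "l < m" "m \<le> 2 ^ k + 1"
      by (auto simp: S_def)
    then have "adjacent (shift_graph k) (i, l) (l, m)"
      using that by (auto simp: adjacent_shift_graph shift_verts_def)
    with m(1) assms show False
      by (auto simp: proper_coloring_def adjacent_shift_graph)
  qed
  \<comment> \<open>The last index is included, its color set being empty. This extra index makes
    the final inequality \<open>2 ^ k < 2 ^ n\<close> strict.\<close>
  have "inj_on S {1..2 ^ k + 1}"
    by (rule linorder_inj_onI) (use neq in auto)
  moreover have "S ` {1..2 ^ k + 1} \<subseteq> Pow {..<n}"
    using assms by (auto simp: S_def proper_coloring_def shift_verts_def)
  ultimately have "card {1..2 ^ k + 1 :: int} \<le> card (Pow {..<n})"
    by (rule card_inj_on_le) simp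
  then have "2 ^ k + 1 \<le> (2 :: nat) ^ n"
    by (simp add: card_Pow nat_add_distrib nat_power_eq)
  then have "2 ^ k < (2 :: nat) ^ n"
    by (rule less_le_trans[rotated]) simp
  then show ?thesis by simp
qed

text \<open>Guarantees that the \<open>LEAST\<close> in \<open>chromatic_number\<close> is attained;
  an injective numbering of the vertices is a proper coloring.\<close>

lemma ex_proper_coloring:
  assumes "simple_graph G"
  shows "\<exists>n c. proper_coloring G n c"
proof -
  from assms have "finite (verts G)" by (simp add: simple_graph_def)
  from finite_imp_inj_to_nat_seg[OF this] obtain c :: "'a \<Rightarrow> nat" and n
    where c: "c ` verts G = {i. i < n}" "inj_on c (verts G)" by blast
  have "c u \<noteq> c v" if "u \<in> verts G" "v \<in> verts G" "adjacent G u v" for u v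
  proof -
    have "card {u, v} = 2" using assms that by (auto simp: simple_graph_def adjacent_def)
    then have "u \<noteq> v" by auto
    with c(2) that show ?thesis by (auto dest: inj_onD)
  qed
  with c(1) have "proper_coloring G n c" unfolding proper_coloring_def by blast
  then show ?thesis by blast
qed

lemma less_chromatic_number_shift_graph: "k < chromatic_number (shift_graph k)"
proof -
  have "\<exists>c. proper_coloring (shift_graph k) (chromatic_number (shift_graph k)) c"
    unfolding chromatic_number_def
    by (rule LeastI_ex) (rule ex_proper_coloring[OF simple_graph_shift_graph])
  then show ?thesis using proper_coloring_shift_graph_imp_less by blast
qed

theorem theorem4:
  shows "ramsey_sequence shift_graph \<and>
         ascending shift_graph \<and>
         (\<forall>k\<ge>1. clique_number (shift_graph k) = 2) \<and>
         filterlim (\<lambda>k. chromatic_number (shift_graph k)) at_top sequentially"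
proof (intro conjI allI impI)
  show "filterlim (\<lambda>k. chromatic_number (shift_graph k)) at_top sequentially"
    \<comment> \<open>The chromatic numbers dominate the identity sequence, which diverges.\<close>
    by (rule filterlim_at_top_mono[OF filterlim_ident])
      (simp add: less_imp_le less_chromatic_number_shift_graph)
qed (fact ramsey_sequence_shift_graph ascending_shift_graph clique_number_shift_graph)+

end
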